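(* There exist infinitely many (pairwise non-isomorphic) graphs $G$ with $\Delta(G) = 6$ and $\chi_c'(G) = 6+\frac{2}{3}$.
   Context: Graphs are finite and simple (no loops, no parallel edges). $\Delta(G)$ denotes the maximum degree of $G$. For a real number $r$, a circular $r$-edge-colouring of $G$ is a map $c$ assigning to each edge of $G$ a real number in $[0,r)$ such that any two distinct edges $e,f$ sharing an end-vertex satisfy $1\le |c(e)-c(f)|\le r-1$. The circular chromatic index $\chi_c'(G)$ is the infimum (attained for finite graphs) of all $r$ such that $G$ admits a circular $r$-edge-colouring. *)

theory Defs
  imports Complex_Main
begin

record 'a ugraph =
  verts :: "'a set"
  edges :: "'a set set"

definition simple_graph :: "'a ugraph \<Rightarrow> bool" where
  "simple_graph G \<longleftrightarrow> finite (verts G) \<and> (\<forall>e \<in> edges G. e \<subseteq> verts G \<and> card e = 2)"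

definition degree :: "'a ugraph \<Rightarrow> 'a \<Rightarrow> nat" where
  "degree G v = card {e \<in> edges G. v \<in> e}"

(* Inserting 0 only matters for the graph without vertices. *)
definition max_degree :: "'a ugraph \<Rightarrow> nat" where
  "max_degree G = Max (insert 0 (degree G ` verts G))"

definition graph_iso :: "'a ugraph \<Rightarrow> 'b ugraph \<Rightarrow> bool" where
  "graph_iso G H \<longleftrightarrow> (\<exists>f. bij_betw f (verts G) (verts H) \<and>
     (\<forall>u \<in> verts G. \<forall>v \<in> verts G. {u, v} \<in> edges G \<longleftrightarrow> {f u, f v} \<in> edges H))"

definition circular_edge_colouring :: "real \<Rightarrow> 'a ugraph \<Rightarrow> ('a set \<Rightarrow> real) \<Rightarrow> bool" where
  "circular_edge_colouring r G c \<longleftrightarrow>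
     (\<forall>e \<in> edges G. 0 \<le> c e \<and> c e < r) \<and>
     (\<forall>e \<in> edges G. \<forall>f \<in> edges G. e \<noteq> f \<and> e \<inter> f \<noteq> {} \<longrightarrow>
        1 \<le> \<bar>c e - c f\<bar> \<and> \<bar>c e - c f\<bar> \<le> r - 1)"

(* For a graph with at least one edge the set is bounded below by 0; for an edgeless graph
   it is all of the reals and the value is meaningless. *)
definition circular_chromatic_index :: "'a ugraph \<Rightarrow> real" where
  "circular_chromatic_index G = Inf {r. \<exists>c. circular_edge_colouring r G c}"

end

(* A graph with 11 vertices and 33 edges has at most 5 edges in any unit arc of a colouring, so r
   is at least 33/5. If moreover r < 20/3, then in the cyclic order of the edges by colour every
   five consecutive edges are disjoint, since 33/5 and 20/3 are Farey neighbours. In such a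
   list two consecutive occurrences of a vertex are 5 or 6 places apart, and of the two ends of an
   edge one moves by 5 and the other by 6. Both return after exactly six moves, and by simplicity
   they do not meet in between, so the end that leaves by 5 has arrived by 6 and conversely. Hence
   the two ends alternate 5, 6 and 6, 5, and they meet after 11 places, a contradiction.
   Isolated vertices then turn one such graph with a circular 20/3-colouring into infinitely many. *)
theory Submission
  imports Defs
begin

section \<open>Cyclic sequences of edges on eleven vertices\<close>

text \<open>Six disjoint pairs would need 12 vertices. Applied to edges in colour order, this keeps
  a sixth edge out of every unit arc.\<close>

lemma no_six_disjoint_pairs:
  fixes F :: "nat \<Rightarrow> 'a set"
  assumes "finite V" "card V = 11" "\<And>i. F i \<subseteq> V" "\<And>i. card (F i) = 2"
  shows "\<exists>a b. i \<le> a \<and> a < b \<and> b \<le> i + 5 \<and> F a \<inter> F b \<noteq> {}"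
proof (rule ccontr)
  assume H: "\<not> ?thesis"
  have disj: "F a \<inter> F b = {}" if "a \<in> {i..i+5}" "b \<in> {i..i+5}" "a \<noteq> b" for a b
    using H that by (cases "a < b") (force simp: Int_commute)+
  have fin: "finite (F a)" for a
    using assms(1,3) finite_subset by blast
  have "card (\<Union>a\<in>{i..i+5}. F a) = (\<Sum>a\<in>{i..i+5}. card (F a))"
    using disj fin by (intro card_UN_disjoint) auto
  also have "\<dots> = 12"
    using assms(4) by simp
  finally have "12 \<le> card V"
    by (metis UN_least assms(1,3) card_mono)
  then show False
    using assms(2) by simp
qed

lemma moves_bounds:
  fixes A :: "nat \<Rightarrow> nat"
  assumes "\<And>k. A (Suc k) = A k + 5 \<or> A (Suc k) = A k + 6"
  shows "A 0 + 5 * k \<le> A k \<and> A k \<le> A 0 + 6 * k"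
proof (induction k)
  case (Suc k)
  then show ?case
    using assms[of k] by auto
qed simp

text \<open>The combinatorial core: of a colouring only the cyclic order of the edges is left. The
  order is unrolled to \<open>nat\<close>, so that moves can be added up without reduction modulo
  33.\<close>

lemma no_cyclic_sequence:
  fixes F :: "nat \<Rightarrow> 'a set"
  assumes V: "finite V" "card V = 11" and sub: "\<And>i. F i \<subseteq> V" and card2: "\<And>i. card (F i) = 2"
    and per: "\<And>i. F (i + 33) = F i"
    and neq: "\<And>i j. i < j \<Longrightarrow> j < i + 33 \<Longrightarrow> F i \<noteq> F j"
    and disj: "\<And>i j. i < j \<Longrightarrow> j \<le> i + 4 \<Longrightarrow> F i \<inter> F j = {}"
  shows False
proof -
  have fin: "finite (F i)" for i
    using V(1) sub finite_subset by blast
  have once: "i = j" if "v \<in> F i" "v \<in> F j" "i \<le> j + 4" "j \<le> i + 4" for v i j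
    using disj[of i j] disj[of j i] that by (cases i j rule: linorder_cases) auto
  have pair: "F i = {a, b}" if "a \<in> F i" "b \<in> F i" "a \<noteq> b" for a b i
    using card2[of i] that fin[of i] by (metis card_2_iff insertE insert_commute singletonD)
  \<comment> \<open>If \<open>v\<close> is missed, the four inner edges use 8 of the other 10
    vertices. Both outer edges avoid these 8, so they have only two vertices left and coincide,
    against \<open>neq\<close>.\<close>
  have cover: "\<exists>j. i \<le> j \<and> j \<le> i + 5 \<and> v \<in> F j" if "v \<in> V" for v i
  proof (rule ccontr)
    assume H: "\<not> ?thesis"
    let ?U = "\<Union>j\<in>{i+1..i+4}. F j"
    have "card ?U = (\<Sum>j\<in>{i+1..i+4}. card (F j))"
      using once fin by (intro card_UN_disjoint) (auto; fastforce)+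
    also have "\<dots> = 8"
      using card2 by simp
    finally have "card ?U = 8" .
    moreover have "?U \<inter> (F i \<union> F (i+5)) = {}"
      using once by (auto; fastforce)
    ultimately have "card (?U \<union> (F i \<union> F (i+5))) = 8 + card (F i \<union> F (i+5))"
      using fin by (subst card_Un_disjoint) auto
    moreover have "card (?U \<union> (F i \<union> F (i+5))) \<le> card (V - {v})"
    proof (rule card_mono)
      have "F j \<subseteq> V - {v}" if "i \<le> j" "j \<le> i + 5" for j
        using sub[of j] H that by blast
      then show "?U \<union> (F i \<union> F (i+5)) \<subseteq> V - {v}"
        by (intro Un_least UN_least) auto
    qed (use V(1) in simp)
    ultimately have le: "card (F i \<union> F (i+5)) \<le> 2"
      using V that by simp
    have "F i = F i \<union> F (i+5)" "F (i+5) = F i \<union> F (i+5)"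
      by (rule card_seteq; use le card2 fin in simp)+
    then show False
      using neq[of i "i+5"] by simp
  qed
  have step: "v \<in> F (p+5) \<or> v \<in> F (p+6)" if v: "v \<in> F p" for v p
  proof -
    obtain j where j: "p + 1 \<le> j" "j \<le> p + 6" "v \<in> F j"
      using cover[of v "p+1"] v sub by fastforce
    with once[OF v j(3)] have "j = p + 5 \<or> j = p + 6"
      by linarith
    with j show ?thesis by blast
  qed
  define nxt where "nxt v p = (if v \<in> F (p+5) then p+5 else p+6)" for v p
  have nxt: "v \<in> F (nxt v p)" if "v \<in> F p" for v p
    using step[OF that] by (auto simp: nxt_def)
  have nxt_cases: "nxt v p = p+5 \<or> nxt v p = p+6" for v p
    by (simp add: nxt_def)
  \<comment> \<open>Places 27 and 28 are the last stops before the return at \<open>p + 33\<close>: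
    the end that leaves by 5 arrives by 6, and conversely.\<close>
  have ends: "a \<in> F (p+27) \<and> b \<in> F (p+28)"
    if p: "a \<in> F p" "b \<in> F p" and ab: "a \<in> F (p+5)" "b \<in> F (p+6)" for a b p
  proof -
    define A where "A k = (nxt a ^^ k) p" for k
    define B where "B k = (nxt b ^^ k) p" for k
    have A0: "A 0 = p" and B0: "B 0 = p"
      by (simp_all add: A_def B_def)
    have AS: "A (Suc k) = A k + 5 \<or> A (Suc k) = A k + 6"
      and BS: "B (Suc k) = B k + 5 \<or> B (Suc k) = B k + 6" for k
      using nxt_cases by (simp_all add: A_def B_def)
    have Ain: "a \<in> F (A k)" and Bin: "b \<in> F (B k)" for k
      by (induction k) (use p nxt in \<open>simp_all add: A_def B_def\<close>)
    have neab: "a \<noteq> b"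
      using once[of a "p+5" "p+6"] ab by auto
    have bounds: "p + 5 * k \<le> A k" "A k \<le> p + 6 * k" "p + 5 * k \<le> B k" "B k \<le> p + 6 * k" for k
      using moves_bounds[of A k] moves_bounds[of B k] AS BS A0 B0 by auto
    \<comment> \<open>Six moves cover between 30 and 36 places, so they end within 3 of the
      occurrence of \<open>a\<close> at \<open>p + 33\<close>, and \<open>once\<close> identifies
      the two.\<close>
    have A6: "A 6 = p + 33"
      using once[OF Ain[of 6], of "p+33"] p per[of p] bounds[of 6] by simp
    have B6: "B 6 = p + 33"
      using once[OF Bin[of 6], of "p+33"] p per[of p] bounds[of 6] by simp
    \<comment> \<open>If the ends met, the edge \<open>F p\<close> would recur after 5 to 30 places,
      before a full turn.\<close>
    have apart: "A k \<noteq> B k" if "1 \<le> k" "k \<le> 5" for k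
    proof
      assume "A k = B k"
      then have "F (A k) = F p"
        using Ain[of k] Bin[of k] p neab pair by metis
      moreover have "p < A k" "A k < p + 33"
        using bounds[of k] that by linarith+
      ultimately show False
        using neq[of p "A k"] by simp
    qed
    have "A 1 = p + 5"
      using ab by (simp add: A_def nxt_def)
    moreover have "B 1 = p + 6"
      using once[of b "p+5" "p+6"] ab by (auto simp: B_def nxt_def)
    ultimately have lt1: "A 1 < B 1" by simp
    \<comment> \<open>Moves differ by at most one, so \<open>A\<close> could only overtake
      \<open>B\<close> by first meeting it, which \<open>apart\<close> excludes.\<close>
    have up: "A (Suc k) < B (Suc k)" if "A k < B k" "k \<le> 4" for k
      using that AS[of k] BS[of k] apart[of "Suc k"] by auto
    have "A 2 < B 2" using up[OF lt1] by (simp add: numeral_2_eq_2)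
    then have "A 3 < B 3" using up[of 2] by simp
    then have "A 4 < B 4" using up[of 3] by simp
    then have "A 5 < B 5" using up[of 4] by simp
    then have "A 5 = p + 27" "B 5 = p + 28"
      using A6 B6 AS[of 5] BS[of 5] by auto
    then show ?thesis
      using Ain[of 5] Bin[of 5] by simp
  qed
  \<comment> \<open>Two ends making the same move would repeat the edge \<open>F p\<close>.\<close>
  have split: "(a \<in> F (p+5) \<and> b \<in> F (p+6)) \<or> (b \<in> F (p+5) \<and> a \<in> F (p+6))"
    if "F p = {a, b}" "a \<noteq> b" for a b p
  proof -
    have "\<not> (a \<in> F (p+5) \<and> b \<in> F (p+5))" "\<not> (a \<in> F (p+6) \<and> b \<in> F (p+6))"
      using neq[of p "p+5"] neq[of p "p+6"] pair that by force+
    then show ?thesis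
      using step[of a p] step[of b p] that by blast
  qed
  have other: "\<exists>w. F q = {v, w} \<and> v \<noteq> w" if "v \<in> F q" for v q
    using card2[of q] that by (metis card_2_iff doubleton_eq_iff insertE singletonD)
  obtain a b where ab: "F 0 = {a, b}" "a \<noteq> b" "a \<in> F 5" "b \<in> F 6"
  proof -
    obtain a b where "F 0 = {a, b}" "a \<noteq> b"
      using card2[of 0] by (meson card_2_iff)
    then show thesis
      using split[of 0 a b] that[of a b] that[of b a] by (auto simp: insert_commute)
  qed
  have a33: "a \<in> F 33" and b33: "b \<in> F 33"
    using per[of 0] ab by auto
  \<comment> \<open>Otherwise \<open>a\<close> leaves place 5 by 5, and \<open>ends\<close> with
    \<open>p = 5\<close> puts it at 32, too close to 33.\<close>
  have "a \<in> F 11"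
  proof (rule ccontr)
    assume n: "a \<notin> F 11"
    obtain w where w: "F 5 = {a, w}" "a \<noteq> w" using other ab(3) by blast
    have "a \<in> F 32"
      using split[of 5 a w] w n ends[of a 5 w] by auto
    then show False using once[OF _ a33, of 32] by simp
  qed
  \<comment> \<open>Otherwise \<open>b\<close> leaves place 6 by 6, and \<open>ends\<close> with
    \<open>p = 6\<close> puts it at 34, again too close to 33.\<close>
  moreover have "b \<in> F 11"
  proof (rule ccontr)
    assume n: "b \<notin> F 11"
    obtain w where w: "F 6 = {b, w}" "b \<noteq> w" using other ab(4) by blast
    have "b \<in> F 34"
      using split[of 6 b w] w n ends[of w 6 b] by auto
    then show False using once[OF _ b33, of 34] by simp
  qed
  ultimately have "F 11 = F 0"
    using pair ab(1,2) by metis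
  then show False
    using neq[of 0 11] by simp
qed

section \<open>The lower bound\<close>

text \<open>The set \<open>V\<close> is kept apart from \<open>verts G\<close>, so that the bound
  survives the addition of isolated vertices.\<close>

lemma circular_edge_colouring_lower_bound:
  fixes G :: "'a ugraph"
  assumes col: "circular_edge_colouring r G c"
    and V: "finite V" "card V = 11" and card33: "card (edges G) = 33"
    and edge: "\<And>e. e \<in> edges G \<Longrightarrow> e \<subseteq> V \<and> card e = 2"
  shows "20 / 3 \<le> r"
proof (rule ccontr)
  assume "\<not> 20 / 3 \<le> r"
  then have r: "r < 20 / 3" by simp
  have "finite (edges G)"
    using card33 by (metis card.infinite zero_neq_numeral)
  then obtain ys where ys: "set ys = edges G" "distinct ys"
    using finite_distinct_list by blast
  define xs where "xs = sort_key c ys"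
  have xs: "set xs = edges G" "distinct xs" "sorted (map c xs)"
    using ys by (simp_all add: xs_def)
  have len: "length xs = 33"
    using distinct_card[OF xs(2)] xs(1) card33 by simp
  define F where "F i = xs ! (i mod 33)" for i
  (* D lifts the colours from the circle of length r to the line. *)
  define D where "D i = c (F i) + r * real (i div 33)" for i
  have F: "F i \<in> edges G" for i
    using nth_mem[of "i mod 33" xs] xs(1) len by (simp add: F_def)
  have range: "0 \<le> c (F i)" "c (F i) < r" for i
    using col F by (auto simp: circular_edge_colouring_def)
  have neq: "F i \<noteq> F j" if "i < j" "j < i + 33" for i j
  proof -
    have "\<not> 33 dvd j - i"
      using that by (intro nat_dvd_not_less) auto
    then have "i mod 33 \<noteq> j mod 33"
      using that mod_eq_dvd_iff_nat[of i j 33] by simp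
    then show ?thesis
      using xs(2) len by (simp add: F_def nth_eq_iff_index_eq)
  qed
  have D_Suc: "D i \<le> D (Suc i)" for i
  proof (cases "Suc i mod 33 = 0")
    \<comment> \<open>At the wrap the colour drops by less than \<open>r\<close>, while the second
      summand of \<open>D\<close> grows by \<open>r\<close>.\<close>
    case True
    then have "Suc i div 33 = Suc (i div 33)"
      by (simp add: div_Suc)
    then have "D (Suc i) = c (F (Suc i)) + r + r * real (i div 33)"
      by (simp add: D_def algebra_simps)
    then show ?thesis
      using range[of i] range[of "Suc i"] by (simp add: D_def)
  next
    case False
    then have *: "Suc i div 33 = i div 33" "Suc i mod 33 = Suc (i mod 33)"
      by (simp_all add: div_Suc mod_Suc split: if_splits)
    then have "Suc (i mod 33) < 33"
      by (metis mod_less_divisor zero_less_numeral)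
    then have "c (F i) \<le> c (F (Suc i))"
      using sorted_nth_mono[OF xs(3), of "i mod 33" "Suc (i mod 33)"] len *
      by (simp add: F_def)
    then show ?thesis
      using * by (simp add: D_def)
  qed
  have D_mono: "D i \<le> D j" if "i \<le> j" for i j
    using lift_Suc_mono_le[of D] D_Suc that by blast
  \<comment> \<open>For meeting edges in the same turn the lower bound 1 on the colour difference
    contradicts \<open>lt\<close>; if \<open>j\<close> is in the next turn, the upper bound
    \<open>r - 1\<close> does.\<close>
  have disj: "F i \<inter> F j = {}" if ij: "i < j" "j < i + 33" and lt: "D j < D i + 1" for i j
  proof (rule ccontr)
    assume "F i \<inter> F j \<noteq> {}"
    then have b: "1 \<le> \<bar>c (F i) - c (F j)\<bar>" "\<bar>c (F i) - c (F j)\<bar> \<le> r - 1"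
      using col F neq[OF ij] by (auto simp: circular_edge_colouring_def)
    have le: "D i \<le> D j"
      using D_mono ij by simp
    have "i div 33 \<le> j div 33" "j div 33 \<le> (i + 33) div 33"
      using ij by (intro div_le_mono; simp)+
    then have "j div 33 = i div 33 \<or> j div 33 = i div 33 + 1"
      by auto
    then show False
    proof
      assume "j div 33 = i div 33"
      then show False using b lt le by (simp add: D_def)
    next
      assume "j div 33 = i div 33 + 1"
      then have "D j = c (F j) + r + r * real (i div 33)"
        by (simp add: D_def algebra_simps)
      then show False using b lt le by (simp add: D_def)
    qed
  qed
  have five: "D i + 1 \<le> D (i + 5)" for i
  proof (rule ccontr)
    assume H: "\<not> ?thesis"
    obtain a b where ab: "i \<le> a" "a < b" "b \<le> i + 5" "F a \<inter> F b \<noteq> {}"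
      using no_six_disjoint_pairs[of V F i] V F edge by blast
    have "D b \<le> D (i + 5)" "D i \<le> D a"
      using D_mono ab by auto
    then show False
      using disj[of a b] ab H by simp
  qed
  have many: "D i + real k \<le> D (i + 5 * k)" for i k
  proof (induction k)
    case (Suc k)
    then show ?case
      using five[of "i + 5 * k"] by (simp add: algebra_simps)
  qed simp
  (* Otherwise the 99 = 4 + 5 * 19 places of three turns would have length at least 20 > 3 * r. *)
  have four: "D (i + 4) < D i + 1" for i
  proof (rule ccontr)
    assume "\<not> ?thesis"
    moreover have "D (i + 4) + 19 \<le> D (i + 99)"
      using many[of "i + 4" 19] by (simp add: add.assoc)
    moreover have "D (i + 99) = D i + 3 * r"
    proof -
      have "(i + 99) mod 33 = i mod 33" "(i + 99) div 33 = i div 33 + 3"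
        using mod_mult_self2[of i 33 3] div_mult_self2[of 33 i 3] by simp_all
      then show ?thesis
        by (simp add: D_def F_def algebra_simps)
    qed
    ultimately show False using r by simp
  qed
  show False
  proof (rule no_cyclic_sequence[of V F])
    show "F i \<inter> F j = {}" if "i < j" "j \<le> i + 4" for i j
    proof (rule disj)
      show "D j < D i + 1"
        using four[of i] D_mono[OF that(2)] by simp
    qed (use that in auto)
    show "F (i + 33) = F i" for i
      by (simp add: F_def)
  qed (use V F edge neq in blast)+
qed

section \<open>A graph attaining the bound\<close>

(* The entry ((u, v), k) stands for the edge uv with colour k / 3 on a circle of length 20 / 3. *)
definition colour_table :: "((nat \<times> nat) \<times> nat) list" where
  "colour_table = [
    ((0, 6), 0), ((5, 9), 0), ((1, 2), 1), ((8, 10), 1), ((4, 7), 2),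
    ((0, 5), 3), ((3, 6), 3), ((1, 10), 4), ((2, 8), 4), ((4, 9), 5),
    ((0, 7), 6), ((5, 6), 6), ((1, 8), 7), ((2, 3), 7), ((9, 10), 8),
    ((0, 4), 9), ((6, 7), 9), ((1, 5), 10), ((3, 8), 10), ((2, 9), 11),
    ((0, 10), 12), ((4, 6), 12), ((3, 5), 13), ((7, 8), 13), ((1, 9), 14),
    ((2, 6), 15), ((4, 10), 15), ((0, 3), 16), ((5, 7), 16), ((8, 9), 17),
    ((1, 4), 18), ((2, 10), 18), ((3, 7), 19)
  ]"

definition base_pairs :: "(nat \<times> nat) list" where
  "base_pairs = map fst colour_table"

definition base_edges :: "nat set set" where
  "base_edges = (\<lambda>(u, v). {u, v}) ` set base_pairs"

text \<open>\<open>Min\<close> and \<open>Max\<close> recover the key of an edge, since the table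
  lists the smaller end first.\<close>

definition base_colouring :: "nat set \<Rightarrow> real" where
  "base_colouring e = real (the (map_of colour_table (Min e, Max e))) / 3"

lemma base_pairs_ordered: "\<forall>(u, v) \<in> set base_pairs. u < v \<and> v < 11"
  by code_simp

lemma distinct_base_pairs: "distinct base_pairs"
  by code_simp

lemma length_base_pairs: "length base_pairs = 33"
  by code_simp

lemma base_pairs_degree:
  "\<forall>w \<in> set [0..<11]. length (filter (\<lambda>(u, v). w = u \<or> w = v) base_pairs) = 6"
  by code_simp

text \<open>The colouring condition for \<open>r = 20 / 3\<close> multiplied by 3, so that it can be
  evaluated in \<open>nat\<close>: 3 stands for 1 and 17 for \<open>r - 1\<close>. The additive form
  avoids truncated subtraction.\<close>

lemma colour_table_proper:
  "\<forall>((u, v), k) \<in> set colour_table. k < 20 \<and> (\<forall>((x, y), l) \<in> set colour_table.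
     (u, v) \<noteq> (x, y) \<and> (u = x \<or> u = y \<or> v = x \<or> v = y) \<longrightarrow>
     (3 + l \<le> k \<and> k \<le> l + 17) \<or> (3 + k \<le> l \<and> l \<le> k + 17))"
  by code_simp

lemma inj_on_base_pairs: "inj_on (\<lambda>(u, v). {u, v}) (set base_pairs)"
proof (rule inj_onI)
  fix p q
  assume "p \<in> set base_pairs" "q \<in> set base_pairs"
    and "(case p of (u, v) \<Rightarrow> {u, v}) = (case q of (u, v) \<Rightarrow> {u, v})"
  then show "p = q"
    using bspec[OF base_pairs_ordered, of p] bspec[OF base_pairs_ordered, of q]
    by (cases p; cases q) (auto simp: doubleton_eq_iff)
qed

lemma base_edgesE:
  assumes "e \<in> base_edges"
  obtains u v k where "e = {u, v}" "u < v" "v < 11" "((u, v), k) \<in> set colour_table"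
    "base_colouring e = real k / 3"
proof -
  obtain u v where uv: "e = {u, v}" "(u, v) \<in> set base_pairs"
    using assms by (auto simp: base_edges_def)
  then obtain k where k: "((u, v), k) \<in> set colour_table"
    by (auto simp: base_pairs_def)
  have "u < v" "v < 11"
    using uv(2) base_pairs_ordered by auto
  moreover have "map_of colour_table (u, v) = Some k"
    using k distinct_base_pairs by (simp add: base_pairs_def)
  ultimately show thesis
    using that[of u v k] uv(1) k by (simp add: base_colouring_def)
qed

lemma base_edges_pair: "e \<in> base_edges \<Longrightarrow> e \<subseteq> {..<11} \<and> card e = 2"
  by (auto elim!: base_edgesE)

lemma card_base_edges: "card base_edges = 33"
  unfolding base_edges_def
  using card_image[OF inj_on_base_pairs] distinct_card[OF distinct_base_pairs] length_base_pairs
  by simp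

lemma card_base_edges_at:
  assumes "w < 11"
  shows "card {e \<in> base_edges. w \<in> e} = 6"
proof -
  let ?S = "filter (\<lambda>(u, v). w = u \<or> w = v) base_pairs"
  have "{e \<in> base_edges. w \<in> e} = (\<lambda>(u, v). {u, v}) ` set ?S"
    by (auto simp: base_edges_def)
  moreover have "inj_on (\<lambda>(u, v). {u, v}) (set ?S)"
    using inj_on_base_pairs by (rule inj_on_subset) auto
  ultimately have "card {e \<in> base_edges. w \<in> e} = card (set ?S)"
    by (simp add: card_image)
  also have "\<dots> = length ?S"
    using distinct_base_pairs by (intro distinct_card distinct_filter)
  finally show ?thesis
    using base_pairs_degree assms by simp
qed

section \<open>Infinitely many graphs by adding isolated vertices\<close>

definition padded_graph :: "nat \<Rightarrow> nat ugraph" where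
  "padded_graph n = \<lparr>verts = {..<11 + n}, edges = base_edges\<rparr>"

lemma simple_padded_graph: "simple_graph (padded_graph n)"
  using base_edges_pair by (fastforce simp: simple_graph_def padded_graph_def)

lemma degree_padded_graph: "degree (padded_graph n) w = (if w < 11 then 6 else 0)"
proof (cases "w < 11")
  case False
  then have "{e \<in> base_edges. w \<in> e} = {}"
    using base_edges_pair by fastforce
  with False show ?thesis
    by (simp only: degree_def padded_graph_def ugraph.simps card.empty if_False)
qed (simp add: degree_def padded_graph_def card_base_edges_at)

lemma max_degree_padded_graph: "max_degree (padded_graph n) = 6"
  unfolding max_degree_def
proof (rule Max_eqI)
  show "6 \<in> insert 0 (degree (padded_graph n) ` verts (padded_graph n))"
  proof -
    have "0 \<in> verts (padded_graph n)" "degree (padded_graph n) 0 = 6"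
      by (simp add: padded_graph_def, simp add: degree_padded_graph)
    then show ?thesis by (metis image_eqI insertI2)
  qed
qed (auto simp: degree_padded_graph, simp add: padded_graph_def)

lemma padded_graph_colouring:
  "circular_edge_colouring (20 / 3) (padded_graph n) base_colouring"
  unfolding circular_edge_colouring_def
proof (intro conjI ballI impI)
  fix e assume "e \<in> edges (padded_graph n)"
  then obtain u v k where e: "((u, v), k) \<in> set colour_table" "base_colouring e = real k / 3"
    by (auto simp: padded_graph_def elim!: base_edgesE)
  then have "k < 20"
    using bspec[OF colour_table_proper e(1)] by simp
  then show "0 \<le> base_colouring e" "base_colouring e < 20 / 3"
    using e(2) by simp_all
next
  fix e f assume ef: "e \<in> edges (padded_graph n)" "f \<in> edges (padded_graph n)"
    and adj: "e \<noteq> f \<and> e \<inter> f \<noteq> {}"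
  obtain u v k where e: "e = {u, v}" "((u, v), k) \<in> set colour_table"
      "base_colouring e = real k / 3"
    using ef(1) by (auto simp: padded_graph_def elim!: base_edgesE)
  obtain x y l where f: "f = {x, y}" "((x, y), l) \<in> set colour_table"
      "base_colouring f = real l / 3"
    using ef(2) by (auto simp: padded_graph_def elim!: base_edgesE)
  have "(u, v) \<noteq> (x, y) \<and> (u = x \<or> u = y \<or> v = x \<or> v = y)"
    using adj e(1) f(1) by auto
  then have "(3 + l \<le> k \<and> k \<le> l + 17) \<or> (3 + k \<le> l \<and> l \<le> k + 17)"
    using bspec[OF conjunct2[OF bspec[OF colour_table_proper e(2), unfolded prod.case]] f(2)]
    by simp
  then show "1 \<le> \<bar>base_colouring e - base_colouring f\<bar>"
    "\<bar>base_colouring e - base_colouring f\<bar> \<le> 20 / 3 - 1"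
    unfolding e(3) f(3) by auto
qed

lemma circular_chromatic_index_padded_graph:
  "circular_chromatic_index (padded_graph n) = 6 + 2 / 3"
proof -
  have "20 / 3 \<le> r" if "circular_edge_colouring r (padded_graph n) c" for r c
    using that by (rule circular_edge_colouring_lower_bound[where V = "{..<11}"])
      (use base_edges_pair card_base_edges in \<open>auto simp: padded_graph_def\<close>)
  then have "circular_chromatic_index (padded_graph n) = 20 / 3"
    unfolding circular_chromatic_index_def
    using padded_graph_colouring by (intro cInf_eq_minimum) auto
  then show ?thesis by simp
qed

text \<open>The number of vertices, \<open>11 + n\<close>, is an isomorphism invariant and
  determines \<open>n\<close>.\<close>

lemma padded_graph_iso_imp_eq:
  assumes "graph_iso (padded_graph m) (padded_graph n)"
  shows "m = n"
proof -
  obtain f where "bij_betw f {..<11 + m} {..<11 + n}"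
    using assms by (auto simp: graph_iso_def padded_graph_def)
  then show ?thesis
    using bij_betw_same_card by fastforce
qed

theorem theorem1:
  "\<exists>\<G> :: nat ugraph set. infinite \<G> \<and>
     (\<forall>G \<in> \<G>. simple_graph G \<and> max_degree G = 6 \<and> circular_chromatic_index G = 6 + 2 / 3) \<and>
     (\<forall>G \<in> \<G>. \<forall>H \<in> \<G>. G \<noteq> H \<longrightarrow> \<not> graph_iso G H)"
proof (intro exI conjI)
  have "inj padded_graph"
    by (auto simp: inj_def padded_graph_def)
  then show "infinite (range padded_graph)"
    by (metis finite_imageD infinite_UNIV_nat)
qed (use simple_padded_graph max_degree_padded_graph circular_chromatic_index_padded_graph
      padded_graph_iso_imp_eq in blast)+

end
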